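(* Let $n,q\in\mathbb{N}$, $\alpha,\beta\in\,]-1,+\infty[$, $t_\tau\in[0,1]$, $h>0$, let $I\subset\mathbb{R}$ be an open interval, and let $f^\delta=f+\varpi$ be a noisy function on $I$, where $f\in\mathcal{C}^{n+1+q}(I)$ and $\varpi$ is a bounded and integrable noise with noise level $\delta$. Assume that there exists $M_{n+1+q}>0$ such that $|f^{(n+q+1)}(x)|\le M_{n+1+q}$ for all $x\in I$. Then $$\left\|D^{(n)}_{h,\alpha,\beta,q}f^\delta(x-t_\tau h)-f^{(n)}(x-t_\tau h)\right\|_\infty\le C_{q,t_\tau}h^{q+1}+E_{q,t_\tau}\frac{\delta}{h^n},$$ where $$C_{q,t_\tau}=M_{n+1+q}\left(\frac{1}{(n+1+q)!}\int_0^1\left|u^{n+1+q}Q_{\alpha,\beta,n,q,t_\tau}(u)\right|du+\frac{t_\tau^{q+1}}{(q+1)!}\right),\qquad E_{q,t_\tau}=\int_0^1\left|Q_{\alpha,\beta,n,q,t_\tau}(u)\right|du.$$ Moreover, if $n\ge 1$, $\delta>0$ and one chooses $$h=\left[\frac{nE_{q,t_\tau}}{(q+1)C_{q,t_\tau}}\,\delta\right]^{\frac{1}{n+q+1}},$$ then $$\left\|D^{(n)}_{h,\alpha,\beta,q}f^\delta(x-t_\tau h)-f^{(n)}(x-t_\tau h)\right\|_\infty=\mathcal{O}\left(\delta^{\frac{q+1}{n+1+q}}\right).$$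
   Context: $\mathbb{N}$ contains $0$. $I_h:=\{x\in I:\ [x-h,x]\subset I\}$, and $\|\cdot\|_\infty$ is the supremum over $x\in I_h$. The noise level of $\varpi$ is $\delta=\sup_{x\in I}|\varpi(x)|$. The $\mathcal{O}$ is as $\delta\to0$ with $f,n,q,\alpha,\beta,t_\tau,M_{n+1+q}$ fixed (the implied constant depends only on these, not on $\delta$ or $\varpi$). For $a,b\in\,]-1,+\infty[$ and $k\in\mathbb{N}$, the Jacobi polynomial on $[0,1]$ is $$P_k^{(a,b)}(t)=\sum_{j=0}^{k}\binom{k+a}{j}\binom{k+b}{k-j}(t-1)^{k-j}t^{j},$$ with generalized binomial coefficients $\binom{r}{j}=\frac{r(r-1)\cdots(r-j+1)}{j!}$; the weight is $w_{a,b}(t)=(1-t)^a t^b$. Set $$Q_{\alpha,\beta,n,q,t}(\tau)=w_{\alpha,\beta}(\tau)\sum_{i=0}^{q}C_{\alpha,\beta,n,i}\,P_i^{(\alpha+n,\beta+n)}(t)\,P_{n+i}^{(\alpha,\beta)}(\tau),$$ $$C_{\alpha,\beta,n,i}=\frac{(\beta+\alpha+2n+2i+1)\,\Gamma(\beta+\alpha+2n+i+1)\,\Gamma(n+i+1)}{\Gamma(\beta+n+i+1)\,\Gamma(\alpha+n+i+1)},$$ where in the degenerate case $n=i=0$, $\alpha+\beta=-1$, the product $(\alpha+\beta+1)\Gamma(\alpha+\beta+1)$ is read as its continuous extension $\Gamma(\alpha+\beta+2)=1$. The causal Jacobi estimator of $f^{(n)}$ is defined, for $x\in I_h$, by $$D^{(n)}_{h,\alpha,\beta,q}f^\delta(x-t_\tau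 h)=\frac{1}{(-h)^n}\int_0^1 Q_{\alpha,\beta,n,q,t_\tau}(u)\,f^\delta(x-hu)\,du.$$ *)

theory Defs
  imports "HOL-Analysis.Analysis"
begin

text \<open>On an open set, \<open>(deriv ^^ j) f\<close> restricted to that set depends only on the values of \<open>f\<close>
  there, so iterating the total operator \<open>deriv\<close> yields the derivatives of \<open>f\<close> on \<open>I\<close>.\<close>

definition Ck_on :: "nat \<Rightarrow> real set \<Rightarrow> (real \<Rightarrow> real) \<Rightarrow> bool" where
  "Ck_on k I f \<longleftrightarrow>
     (\<forall>j<k. (deriv ^^ j) f differentiable_on I) \<and> (\<forall>j\<le>k. continuous_on I ((deriv ^^ j) f))"

definition jacobi01 :: "nat \<Rightarrow> real \<Rightarrow> real \<Rightarrow> real \<Rightarrow> real" where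
  "jacobi01 k a b t =
     (\<Sum>j\<le>k. ((real k + a) gchoose j) * ((real k + b) gchoose (k - j)) * (t - 1) ^ (k - j) * t ^ j)"

text \<open>Since \<open>0 powr a = 0\<close> for every \<open>a\<close>, this vanishes at the endpoints \<open>0\<close> and \<open>1\<close> whatever
  \<open>a\<close> and \<open>b\<close> are; it is only ever used under an integral over \<open>{0..1}\<close>.\<close>

definition jacobi_weight :: "real \<Rightarrow> real \<Rightarrow> real \<Rightarrow> real" where
  "jacobi_weight a b t = (1 - t) powr a * t powr b"

text \<open>For \<open>n = i = 0\<close> and \<open>\<alpha> + \<beta> = -1\<close> the first factor is the continuous extension of
  \<open>s * Gamma s = Gamma (s + 1)\<close> to \<open>s = 0\<close>; for all other parameters in range \<open>Gamma\<close> is evaluated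
  away from its poles.\<close>

definition jacobi_coeff :: "real \<Rightarrow> real \<Rightarrow> nat \<Rightarrow> nat \<Rightarrow> real" where
  "jacobi_coeff \<alpha> \<beta> n i =
     (if n = 0 \<and> i = 0 \<and> \<alpha> + \<beta> = -1 then 1
      else (\<beta> + \<alpha> + 2 * real n + 2 * real i + 1) * Gamma (\<beta> + \<alpha> + 2 * real n + real i + 1))
     * Gamma (real n + real i + 1)
     / (Gamma (\<beta> + real n + real i + 1) * Gamma (\<alpha> + real n + real i + 1))"

definition jacobi_kernel :: "real \<Rightarrow> real \<Rightarrow> nat \<Rightarrow> nat \<Rightarrow> real \<Rightarrow> real \<Rightarrow> real" where
  "jacobi_kernel \<alpha> \<beta> n q t \<tau> =
     jacobi_weight \<alpha> \<beta> \<tau> *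
     (\<Sum>i\<le>q. jacobi_coeff \<alpha> \<beta> n i * jacobi01 i (\<alpha> + real n) (\<beta> + real n) t
              * jacobi01 (n + i) \<alpha> \<beta> \<tau>)"

text \<open>\<open>causal_jacobi_estimator n h \<alpha> \<beta> q t g x\<close> estimates the \<open>n\<close>-th derivative of \<open>g\<close> at the
  delayed point \<open>x - t * h\<close>, not at \<open>x\<close>.\<close>

definition causal_jacobi_estimator ::
    "nat \<Rightarrow> real \<Rightarrow> real \<Rightarrow> real \<Rightarrow> nat \<Rightarrow> real \<Rightarrow> (real \<Rightarrow> real) \<Rightarrow> real \<Rightarrow> real" where
  "causal_jacobi_estimator n h \<alpha> \<beta> q t g x =
     1 / (- h) ^ n * integral {0..1} (\<lambda>u. jacobi_kernel \<alpha> \<beta> n q t u * g (x - h * u))"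

definition causal_domain :: "real set \<Rightarrow> real \<Rightarrow> real set" where
  "causal_domain I h = {x \<in> I. {x - h..x} \<subseteq> I}"

text \<open>The supremum is taken in \<open>ennreal\<close>, so that it is \<open>\<infinity>\<close> for unbounded \<open>g\<close> and \<open>0\<close> for
  empty \<open>S\<close>; the latter occurs for \<open>causal_domain I h\<close> when \<open>h\<close> is at least the length of \<open>I\<close>.\<close>

definition sup_norm_on :: "real set \<Rightarrow> (real \<Rightarrow> real) \<Rightarrow> ennreal" where
  "sup_norm_on S g = (SUP x\<in>S. ennreal \<bar>g x\<bar>)"

definition noise_with_level :: "real set \<Rightarrow> real \<Rightarrow> (real \<Rightarrow> real) \<Rightarrow> bool" where
  "noise_with_level I \<delta> \<omega> \<longleftrightarrow>
     bounded (\<omega> ` I) \<and> \<omega> absolutely_integrable_on I \<and> 0 \<le> \<delta> \<and> sup_norm_on I \<omega> = ennreal \<delta>"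

definition estimation_error ::
    "nat \<Rightarrow> real \<Rightarrow> real \<Rightarrow> real \<Rightarrow> nat \<Rightarrow> real \<Rightarrow> real set \<Rightarrow> (real \<Rightarrow> real) \<Rightarrow> (real \<Rightarrow> real) \<Rightarrow> ennreal"
  where
  "estimation_error n h \<alpha> \<beta> q t I f \<omega> =
     sup_norm_on (causal_domain I h)
       (\<lambda>x. causal_jacobi_estimator n h \<alpha> \<beta> q t (\<lambda>y. f y + \<omega> y) x - (deriv ^^ n) f (x - t * h))"

definition bias_const :: "real \<Rightarrow> real \<Rightarrow> nat \<Rightarrow> nat \<Rightarrow> real \<Rightarrow> real \<Rightarrow> real" where
  "bias_const \<alpha> \<beta> n q t M =
     M * (1 / fact (n + 1 + q) *
            integral {0..1} (\<lambda>u. \<bar>u ^ (n + 1 + q) * jacobi_kernel \<alpha> \<beta> n q t u\<bar>)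
          + t ^ (q + 1) / fact (q + 1))"

definition noise_const :: "real \<Rightarrow> real \<Rightarrow> nat \<Rightarrow> nat \<Rightarrow> real \<Rightarrow> real" where
  "noise_const \<alpha> \<beta> n q t = integral {0..1} (\<lambda>u. \<bar>jacobi_kernel \<alpha> \<beta> n q t u\<bar>)"

definition optimal_width :: "real \<Rightarrow> real \<Rightarrow> nat \<Rightarrow> nat \<Rightarrow> real \<Rightarrow> real \<Rightarrow> real \<Rightarrow> real" where
  "optimal_width \<alpha> \<beta> n q t M \<delta> =
     (real n * noise_const \<alpha> \<beta> n q t / (real (q + 1) * bias_const \<alpha> \<beta> n q t M) * \<delta>)
       powr (1 / real (n + q + 1))"

end

theory Submission
  imports Defs
begin

text \<open>
  The kernel \<open>Q\<close> satisfies \<open>\<integral>\<^sub>0\<^sup>1 Q(u) g(u) du = g\<^bsup>(n)\<^esup>(t)\<close> for every polynomial \<open>g\<close> of degree at most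
  \<open>n + q\<close>. Indeed, by Rodrigues' relation, \<open>n\<close> integrations by parts turn the moment of \<open>g\<close> against
  \<open>w\<^bsub>\<alpha>,\<beta>\<^esub> P\<^bsub>n+i\<^esub>\<^bsup>(\<alpha>,\<beta>)\<^esup>\<close> into the moment of \<open>g\<^bsup>(n)\<^esup>\<close> against \<open>w\<^bsub>\<alpha>+n,\<beta>+n\<^esub> P\<^sub>i\<^bsup>(\<alpha>+n,\<beta>+n)\<^esup>\<close>, and the sum defining
  \<open>Q\<close> becomes the expansion of \<open>g\<^bsup>(n)\<^esup>\<close> in orthogonal polynomials, evaluated at \<open>t\<close>; orthogonality and the
  norms follow from the same integration by parts.

  Hence the estimator maps the Taylor polynomial of \<open>f\<close> of degree \<open>n + q\<close> at \<open>x\<close> exactly to the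
  Taylor polynomial of \<open>f\<^bsup>(n)\<^esup>\<close> of degree \<open>q\<close>, evaluated at \<open>x - t h\<close>. What remains are the two Taylor
  remainders and the noise. With the optimal width both terms of the bound are of order
  \<open>\<delta> powr ((q + 1) / (n + 1 + q))\<close>; the width is nonzero because \<open>Q\<close> reproduces the \<open>n\<close>-th derivative of
  \<open>u\<^sup>n\<close> and so does not vanish identically.
\<close>

section \<open>Jacobi polynomials: derivative relation and leading coefficients\<close>

text \<open>A formal polynomial gives access to \<open>degree\<close>, \<open>coeff\<close> and
  \<open>pderiv\<close>, on which the expansion and the integrations by parts rest.\<close>

definition jacobi_poly :: "nat \<Rightarrow> real \<Rightarrow> real \<Rightarrow> real poly" where
  "jacobi_poly k a b =
     (\<Sum>j\<le>k. smult (((real k + a) gchoose j) * ((real k + b) gchoose (k - j)))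
               ([:-1, 1:] ^ (k - j) * [:0, 1:] ^ j))"

lemma poly_jacobi_poly: "poly (jacobi_poly k a b) u = jacobi01 k a b u"
  by (simp add: jacobi_poly_def jacobi01_def poly_sum mult_ac)

lemma gbinomial_Suc_mult:
  fixes a :: real
  shows "(a gchoose k) * (a - real k) = real (Suc k) * (a gchoose Suc k)"
  using gbinomial_mult_1[of a k] by (simp add: algebra_simps)

lemma pderiv_sum: "pderiv (\<Sum>i\<in>A. p i) = (\<Sum>i\<in>A. pderiv (p i))"
  using higher_pderiv_sum[of 1 p A] by simp

text \<open>This is Rodrigues' relation
  \<open>(w\<^bsub>a+1,b+1\<^esub> P\<^sub>k\<^bsup>(a+1,b+1)\<^esup>)' = - (k + 1) w\<^bsub>a,b\<^esub> P\<^bsub>k+1\<^esub>\<^bsup>(a,b)\<^esup>\<close>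
  divided by \<open>w\<^bsub>a,b\<^esub>\<close>.\<close>

lemma jacobi01_Suc_conv_deriv:
  "u * (1 - u) * poly (pderiv (jacobi_poly k (a + 1) (b + 1))) u
     + ((b + 1) * (1 - u) - (a + 1) * u) * jacobi01 k (a + 1) (b + 1) u
   = - real (Suc k) * jacobi01 (Suc k) a b u"
proof -
  define A B where "A = real (Suc k) + a" and "B = real (Suc k) + b"
  \<comment> \<open>Since \<open>k + (a + 1) = Suc k + a\<close>, the entries \<open>A\<close> and
    \<open>B\<close> serve both degrees: \<open>e j\<close> runs through the summands of
    \<open>jacobi01 (Suc k) a b\<close>, and \<open>c j * p j\<close> through those of
    \<open>jacobi01 k (a + 1) (b + 1)\<close>.\<close>
  define e where "e j = (A gchoose j) * (B gchoose (Suc k - j)) * (u - 1) ^ (Suc k - j) * u ^ j" for j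
  define c where "c j = (A gchoose j) * (B gchoose (k - j))" for j
  define p where "p j = (u - 1) ^ (k - j) * u ^ j" for j
  have AB: "real k + (a + 1) = A" "real k + (b + 1) = B" by (simp_all add: A_def B_def)
  \<comment> \<open>The factor \<open>u * (1 - u)\<close> clears the denominators of the logarithmic
    derivative \<open>m / (u - 1) + j / u\<close>.\<close>
  have deriv: "u * (1 - u) * poly (pderiv ([:-1, 1:] ^ m * [:0, 1:] ^ j)) u
                 = (real j * (1 - u) - real m * u) * ((u - 1) ^ m * u ^ j)" for m j :: nat
    by (cases m; cases j)
      (simp_all add: pderiv_mult pderiv_power_Suc pderiv_pCons algebra_simps del: of_nat_Suc power_Suc,
       simp_all add: algebra_simps)
  have summand: "u * (1 - u) * (c j * poly (pderiv ([:-1, 1:] ^ (k - j) * [:0, 1:] ^ j)) u)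
                + ((b + 1) * (1 - u) - (a + 1) * u) * (c j * p j)
              = - (real (Suc j) * e (Suc j)) - real (Suc k - j) * e j" (is "?l = _") if "j \<le> k" for j
  proof -
    have "?l = c j * (u * (1 - u) * poly (pderiv ([:-1, 1:] ^ (k - j) * [:0, 1:] ^ j)) u)
                + ((b + 1) * (1 - u) - (a + 1) * u) * (c j * p j)" by simp
    \<comment> \<open>Collecting multiples of \<open>u\<close> and of \<open>u - 1\<close> leaves
      the factors \<open>A - j\<close> and \<open>B - (k - j)\<close>, exactly those that raise a
      lower binomial index by one.\<close>
    also have "\<dots> = - ((A gchoose j) * (A - real j)) * (B gchoose (k - j)) * u * p j
                 - ((B gchoose (k - j)) * (B - real (k - j))) * (A gchoose j) * (u - 1) * p j"
      using that unfolding deriv by (simp add: p_def c_def A_def B_def of_nat_diff algebra_simps)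
    also have "\<dots> = - (real (Suc j) * e (Suc j)) - real (Suc k - j) * e j"
      using that unfolding gbinomial_Suc_mult e_def p_def
      by (simp add: Suc_diff_le del: of_nat_Suc)
    finally show ?thesis .
  qed
  have "u * (1 - u) * poly (pderiv (jacobi_poly k (a + 1) (b + 1))) u
     + ((b + 1) * (1 - u) - (a + 1) * u) * jacobi01 k (a + 1) (b + 1) u
     = (\<Sum>j\<le>k. u * (1 - u) * (c j * poly (pderiv ([:-1, 1:] ^ (k - j) * [:0, 1:] ^ j)) u)
                + ((b + 1) * (1 - u) - (a + 1) * u) * (c j * p j))"
    by (simp add: jacobi_poly_def jacobi01_def AB c_def p_def pderiv_sum pderiv_smult poly_sum
        sum.distrib sum_distrib_left mult.assoc)
  also have "\<dots> = (\<Sum>j\<le>k. - (real (Suc j) * e (Suc j)) - real (Suc k - j) * e j)"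
    by (intro sum.cong refl summand) simp
  \<comment> \<open>The end terms that are added carry the factor 0; afterwards the two weights of
    each \<open>e j\<close> sum to \<open>Suc k\<close>.\<close>
  also have "\<dots> = - (\<Sum>j\<le>Suc k. real j * e j) - (\<Sum>j\<le>Suc k. real (Suc k - j) * e j)"
  proof -
    have "(\<Sum>j\<le>Suc k. real j * e j) = (\<Sum>j\<le>k. real (Suc j) * e (Suc j))"
      by (subst sum.atMost_Suc_shift) simp
    moreover have "(\<Sum>j\<le>Suc k. real (Suc k - j) * e j) = (\<Sum>j\<le>k. real (Suc k - j) * e j)"
      by simp
    ultimately show ?thesis
      by (simp only: sum_subtractf sum_negf)
  qed
  also have "\<dots> = - (\<Sum>j\<le>Suc k. real (Suc k) * e j)"
  proof -
    have "(\<Sum>j\<le>Suc k. real (Suc k) * e j) = (\<Sum>j\<le>Suc k. real j * e j + real (Suc k - j) * e j)"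
      by (intro sum.cong refl) (simp add: of_nat_diff algebra_simps)
    then show ?thesis by (simp only: sum.distrib)
  qed
  also have "\<dots> = - real (Suc k) * jacobi01 (Suc k) a b u"
    by (simp add: jacobi01_def e_def A_def B_def sum_distrib_left sum_negf del: sum.atMost_Suc of_nat_Suc)
  finally show ?thesis .
qed

text \<open>Each product of powers in the definition is monic of degree \<open>k\<close>, so the
  binomial products simply add up, and Vandermonde's identity applies.\<close>

lemma coeff_jacobi_poly_top:
  "coeff (jacobi_poly k a b) k = (2 * real k + a + b) gchoose k"
proof -
  have "coeff ([:-1, 1:] ^ (k - j) * [:0, 1::real:] ^ j) k = 1" if "j \<le> k" for j
  proof -
    have "degree ([:-1, 1:] ^ (k - j) * [:0, 1::real:] ^ j) = k"
      using that by (simp add: degree_mult_eq degree_power_eq)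
    moreover have "lead_coeff ([:-1, 1:] ^ (k - j) * [:0, 1::real:] ^ j) = 1"
      by (simp add: lead_coeff_mult lead_coeff_power)
    ultimately show ?thesis by metis
  qed
  then have "coeff (jacobi_poly k a b) k
      = (\<Sum>j\<le>k. ((real k + a) gchoose j) * ((real k + b) gchoose (k - j)))"
    by (simp add: jacobi_poly_def coeff_sum)
  also have "\<dots> = ((real k + a) + (real k + b)) gchoose k"
    using gbinomial_Vandermonde[of "real k + a" "real k + b" k] by (simp add: atMost_atLeast0)
  also have "(real k + a) + (real k + b) = 2 * real k + a + b" by simp
  finally show ?thesis .
qed

lemma degree_jacobi_poly_le: "degree (jacobi_poly k a b) \<le> k"
  unfolding jacobi_poly_def
  by (intro degree_sum_le) (auto intro!: order_trans[OF degree_smult_le] simp: degree_mult_eq degree_power_eq)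

lemma jacobi_poly_0 [simp]: "jacobi_poly 0 a b = 1"
  by (simp add: jacobi_poly_def)

text \<open>For \<open>k \<ge> 1\<close> this is a rising factorial starting at
  \<open>k + a + b + 1 > 0\<close>, divided by \<open>fact k\<close>. It permits division by the
  leading coefficient later.\<close>

lemma jacobi_lead_coeff_pos:
  fixes a b :: real
  assumes "-1 < a" "-1 < b"
  shows "0 < (2 * real k + a + b) gchoose k"
proof (cases k)
  case (Suc m)
  then show ?thesis using assms
    by (auto simp: gbinomial_pochhammer' intro!: divide_pos_pos pochhammer_pos)
qed auto

section \<open>Moments against the Jacobi weight and integration by parts\<close>

lemma jacobi_weight_has_integral:
  assumes "-1 < a" "-1 < b"
  shows "(jacobi_weight a b has_integral Beta (a + 1) (b + 1)) {0..1}"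
  using has_integral_Beta_real[of "b + 1" "a + 1"] assms
  by (simp add: jacobi_weight_def[abs_def] mult.commute Beta_commute)

lemma jacobi_weight_nonneg: "0 \<le> jacobi_weight a b u"
  by (simp add: jacobi_weight_def)

text \<open>The weight may be unbounded at the endpoints, so the other factor has to be bounded.
  Asking for measurability instead of continuity admits the noise.\<close>

lemma absolutely_integrable_jacobi_weight_mult:
  assumes "-1 < a" "-1 < b" and "g \<in> borel_measurable (lebesgue_on {0..1})" "bounded (g ` {0..1})"
  shows "(\<lambda>u. jacobi_weight a b u * g u) absolutely_integrable_on {0..1}"
proof -
  have "jacobi_weight a b absolutely_integrable_on {0..1}"
    using jacobi_weight_has_integral[OF assms(1,2)]
    by (intro nonnegative_absolutely_integrable_1) (auto simp: jacobi_weight_nonneg)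
  then have "(\<lambda>u. g u * jacobi_weight a b u) absolutely_integrable_on {0..1}"
    using assms by (intro absolutely_integrable_bounded_measurable_product_real) auto
  then show ?thesis by (simp add: mult.commute)
qed

lemma absolutely_integrable_jacobi_weight_mult_continuous:
  assumes "-1 < a" "-1 < b" and "continuous_on {0..1} g"
  shows "(\<lambda>u. jacobi_weight a b u * g u) absolutely_integrable_on {0..1}"
  using assms
  by (intro absolutely_integrable_jacobi_weight_mult continuous_imp_measurable_on_sets_lebesgue
      compact_imp_bounded compact_continuous_image) auto

definition jacobi_moment :: "real \<Rightarrow> real \<Rightarrow> real poly \<Rightarrow> real" where
  "jacobi_moment a b p = integral {0..1} (\<lambda>u. jacobi_weight a b u * poly p u)"

lemma has_integral_jacobi_moment:
  assumes "-1 < a" "-1 < b"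
  shows "((\<lambda>u. jacobi_weight a b u * poly p u) has_integral jacobi_moment a b p) {0..1}"
  unfolding jacobi_moment_def
  by (intro integrable_integral set_lebesgue_integral_eq_integral(1)
      absolutely_integrable_jacobi_weight_mult_continuous assms continuous_intros)

lemma jacobi_moment_sum:
  assumes "-1 < a" "-1 < b" "finite A"
  shows "jacobi_moment a b (\<Sum>i\<in>A. smult (c i) (p i)) = (\<Sum>i\<in>A. c i * jacobi_moment a b (p i))"
proof -
  have "((\<lambda>u. \<Sum>i\<in>A. c i * (jacobi_weight a b u * poly (p i) u)) has_integral
          (\<Sum>i\<in>A. c i * jacobi_moment a b (p i))) {0..1}"
    using assms by (intro has_integral_sum has_integral_mult_right has_integral_jacobi_moment) auto
  moreover have "(\<lambda>u. \<Sum>i\<in>A. c i * (jacobi_weight a b u * poly (p i) u))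
      = (\<lambda>u. jacobi_weight a b u * poly (\<Sum>i\<in>A. smult (c i) (p i)) u)"
    by (simp add: poly_sum sum_distrib_left mult_ac)
  ultimately show ?thesis
    unfolding jacobi_moment_def by (simp add: integral_unique)
qed

lemma jacobi_moment_const:
  assumes "-1 < a" "-1 < b"
  shows "jacobi_moment a b [:c:] = c * Beta (a + 1) (b + 1)"
  using has_integral_mult_left[OF jacobi_weight_has_integral[OF assms], of c]
  by (simp add: jacobi_moment_def mult.commute[of c] integral_unique[of _ "_ * _"] del: integral_mult_left)

text \<open>Integration by parts with Rodrigues' relation: the boundary terms vanish because the
  raised exponents are positive.\<close>

lemma jacobi_moment_step:
  assumes "-1 < a" "-1 < b"
  shows "real (Suc k) * jacobi_moment a b (jacobi_poly (Suc k) a b * g)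
       = jacobi_moment (a + 1) (b + 1) (jacobi_poly k (a + 1) (b + 1) * pderiv g)"
proof -
  let ?J = "jacobi_poly k (a + 1) (b + 1)" and ?K = "jacobi_poly (Suc k) a b"
  let ?F = "\<lambda>u. jacobi_weight (a + 1) (b + 1) u * poly (?J * g) u"
  let ?F' = "\<lambda>u. jacobi_weight (a + 1) (b + 1) u * poly (?J * pderiv g) u
               - real (Suc k) * (jacobi_weight a b u * poly (?K * g) u)"
  have "(?F' has_integral (?F 1 - ?F 0)) {0..1}"
  \<comment> \<open>If \<open>a\<close> or \<open>b\<close> is negative, the derivative of
    \<open>?F\<close> may be singular at an endpoint; differentiability is therefore asked for in
    the interior only.\<close>
  proof (rule fundamental_theorem_of_calculus_interior)
    show "continuous_on {0..1} ?F"
      unfolding jacobi_weight_def using assms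
      by (auto intro!: continuous_intros continuous_on_powr')
    fix u :: real assume u: "u \<in> {0<..<1}"
    have w: "jacobi_weight (a + 1) (b + 1) u = jacobi_weight a b u * (u * (1 - u))"
      using u by (simp add: jacobi_weight_def powr_add)
    have d1: "((\<lambda>u. (1 - u) powr (a + 1)) has_real_derivative - (a + 1) * (1 - u) powr a) (at u)"
      using u by (auto intro!: derivative_eq_intros simp: algebra_simps)
    have d2: "((\<lambda>u. u powr (b + 1)) has_real_derivative (b + 1) * u powr b) (at u)"
      using u by (auto intro!: derivative_eq_intros)
    have dw: "(jacobi_weight (a + 1) (b + 1) has_real_derivative
            jacobi_weight a b u * ((b + 1) * (1 - u) - (a + 1) * u)) (at u)"
      unfolding jacobi_weight_def[abs_def] using u
      by (intro DERIV_cong[OF DERIV_mult[OF d1 d2]]) (simp add: powr_add algebra_simps)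
    have id: "jacobi_weight a b u * ((b + 1) * (1 - u) - (a + 1) * u) * poly ?J u
          + jacobi_weight (a + 1) (b + 1) u * poly (pderiv ?J) u
        = - real (Suc k) * (jacobi_weight a b u * poly ?K u)"
      using arg_cong[OF jacobi01_Suc_conv_deriv[of u k a b], of "\<lambda>x. jacobi_weight a b u * x"]
      unfolding w by (simp add: poly_jacobi_poly algebra_simps)
    have "(?F has_real_derivative
       (jacobi_weight a b u * ((b + 1) * (1 - u) - (a + 1) * u) * poly ?J u
          + jacobi_weight (a + 1) (b + 1) u * poly (pderiv ?J) u) * poly g u
        + jacobi_weight (a + 1) (b + 1) u * poly ?J u * poly (pderiv g) u) (at u)"
      by (intro DERIV_cong[OF DERIV_mult[OF dw poly_DERIV]])
        (simp add: pderiv_mult algebra_simps)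
    then have "(?F has_real_derivative ?F' u) (at u)"
      unfolding id by (simp add: algebra_simps)
    then show "(?F has_vector_derivative ?F' u) (at u)"
      by (simp add: has_real_derivative_iff_has_vector_derivative)
  qed auto
  moreover have "?F 1 - ?F 0 = 0" by (simp add: jacobi_weight_def)
  moreover have "(?F' has_integral jacobi_moment (a + 1) (b + 1) (?J * pderiv g)
                   - real (Suc k) * jacobi_moment a b (?K * g)) {0..1}"
    using assms by (intro has_integral_diff has_integral_mult_right has_integral_jacobi_moment) auto
  ultimately show ?thesis
    by (metis (no_types, lifting) has_integral_unique right_minus_eq)
qed

text \<open>Iterating the step \<open>n\<close> times raises both parameters by \<open>n\<close> and
  collects the divisors \<open>n + i\<close> down to \<open>i + 1\<close>, whence the quotient of
  factorials.\<close>

lemma jacobi_moment_higher_pderiv: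
  assumes "-1 < a" "-1 < b"
  shows "jacobi_moment a b (jacobi_poly (n + i) a b * g)
       = fact i / fact (n + i) *
         jacobi_moment (a + n) (b + n) (jacobi_poly i (a + n) (b + n) * (pderiv ^^ n) g)"
  using assms
proof (induction n arbitrary: a b g)
  case (Suc n)
  have "real (Suc (n + i)) * jacobi_moment a b (jacobi_poly (Suc n + i) a b * g)
      = jacobi_moment (a + 1) (b + 1) (jacobi_poly (n + i) (a + 1) (b + 1) * pderiv g)"
    using jacobi_moment_step[OF Suc.prems, of "n + i" g] by simp
  also have "\<dots> = fact i / fact (n + i) * jacobi_moment (a + Suc n) (b + Suc n)
      (jacobi_poly i (a + Suc n) (b + Suc n) * (pderiv ^^ Suc n) g)"
    using Suc.IH[of "a + 1" "b + 1" "pderiv g"] Suc.prems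
    by (simp add: funpow_Suc_right ac_simps del: funpow.simps)
  finally show ?case
    by (simp add: field_simps del: of_nat_Suc funpow.simps)
qed simp

section \<open>Orthogonality, norms and expansion in Jacobi polynomials\<close>

lemma higher_pderiv_eq_0:
  fixes p :: "real poly"
  assumes "degree p < n"
  shows "(pderiv ^^ n) p = 0"
  using assms by (intro poly_eqI) (simp add: coeff_higher_pderiv coeff_eq_0)

text \<open>Moving all \<open>i\<close> derivatives onto \<open>r\<close> annihilates it.\<close>

lemma jacobi_orthogonal:
  assumes "-1 < a" "-1 < b" "degree r < i"
  shows "jacobi_moment a b (jacobi_poly i a b * r) = 0"
  using jacobi_moment_higher_pderiv[OF assms(1,2), of i 0 r] higher_pderiv_eq_0[OF assms(3)]
  by (simp add: jacobi_moment_def)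

text \<open>Here the \<open>i\<close> derivatives leave the constant \<open>fact i\<close> times the
  leading coefficient, integrated against the weight with parameters \<open>a + i\<close> and
  \<open>b + i\<close>.\<close>

lemma jacobi_norm:
  assumes "-1 < a" "-1 < b"
  shows "jacobi_moment a b (jacobi_poly i a b * jacobi_poly i a b)
       = ((2 * real i + a + b) gchoose i) * Beta (a + i + 1) (b + i + 1)"
proof -
  have "(pderiv ^^ i) (jacobi_poly i a b) = [: fact i * ((2 * real i + a + b) gchoose i) :]"
  proof (rule poly_eqI)
    fix m
    show "coeff ((pderiv ^^ i) (jacobi_poly i a b)) m
        = coeff [: fact i * ((2 * real i + a + b) gchoose i) :] m"
      using degree_jacobi_poly_le[of i a b]
      by (cases m) (auto simp: coeff_higher_pderiv coeff_jacobi_poly_top pochhammer_fact coeff_eq_0)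
  qed
  then show ?thesis
    using jacobi_moment_higher_pderiv[OF assms, of i 0 "jacobi_poly i a b"] assms
    by (simp add: jacobi_moment_const)
qed

text \<open>Subtracting a multiple of the top Jacobi polynomial, whose leading coefficient is
  nonzero, lowers the degree bound.\<close>

lemma jacobi_expansion:
  assumes "-1 < a" "-1 < b" "degree r \<le> q"
  shows "\<exists>c. r = (\<Sum>i\<le>q. smult (c i) (jacobi_poly i a b))"
  using assms(3)
proof (induction q arbitrary: r)
  case 0
  then obtain d where "r = [:d:]" by (auto elim: degree_eq_zeroE)
  then show ?case by (intro exI[of _ "\<lambda>_. d"]) simp
next
  case (Suc q)
  let ?J = "jacobi_poly (Suc q) a b"
  define d where "d = coeff r (Suc q) / coeff ?J (Suc q)"
  have J: "coeff ?J (Suc q) \<noteq> 0"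
    using jacobi_lead_coeff_pos[OF assms(1,2), of "Suc q"] by (simp add: coeff_jacobi_poly_top)
  have "degree (r - smult d ?J) \<le> q"
  proof (rule degree_le, intro allI impI)
    fix m assume "q < m"
    show "coeff (r - smult d ?J) m = 0"
    proof (cases "m = Suc q")
      case True
      then show ?thesis using J by (simp add: d_def)
    next
      case False
      with \<open>q < m\<close> have "Suc q < m" by simp
      then show ?thesis
        using Suc.prems degree_jacobi_poly_le[of "Suc q" a b] by (simp add: coeff_eq_0)
    qed
  qed
  then obtain c where c: "r - smult d ?J = (\<Sum>i\<le>q. smult (c i) (jacobi_poly i a b))"
    using Suc.IH by blast
  have "r = (\<Sum>i\<le>Suc q. smult ((c(Suc q := d)) i) (jacobi_poly i a b))"
    using c by (simp add: algebra_simps)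
  then show ?case by blast
qed

text \<open>The coefficient cancels both the factorials from \<open>n\<close> integrations by parts
  and the squared norm of the \<open>i\<close>-th polynomial for the raised parameters. Everything
  is reduced to values of \<open>Gamma\<close>, with \<open>s - i\<close> equal to
  \<open>\<beta> + \<alpha> + 2 * n + i + 1\<close>.\<close>

lemma jacobi_coeff_mult_norm:
  assumes "-1 < \<alpha>" "-1 < \<beta>"
  shows "jacobi_coeff \<alpha> \<beta> n i * (fact i / fact (n + i)) *
           (((2 * real i + (\<alpha> + n) + (\<beta> + n)) gchoose i) * Beta (\<alpha> + n + i + 1) (\<beta> + n + i + 1)) = 1"
proof -
  define s where "s = \<beta> + \<alpha> + 2 * real n + 2 * real i + 1"
  have pos: "\<alpha> + n + i + 1 > 0" "\<beta> + n + i + 1 > 0" "s + 1 > 0"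
    using assms by (simp_all add: s_def)
  then have G: "Gamma (\<alpha> + n + i + 1) > 0" "Gamma (\<beta> + n + i + 1) > 0" "Gamma (s + 1) > 0"
    by (simp_all add: Gamma_real_pos)
  define C where "C = (if n = 0 \<and> i = 0 \<and> \<alpha> + \<beta> = -1 then 1 else s * Gamma (s - i))"
  have C: "C * fact i * ((s - 1) gchoose i) = Gamma (s + 1)"
  proof (cases "i = 0")
    \<comment> \<open>Only here can \<open>s\<close> be nonpositive. As \<open>s > -1\<close>, the
      recurrence of \<open>Gamma\<close> can fail only at \<open>s = 0\<close>, which is exactly the
      degenerate case.\<close>
    case True
    have "s = 0 \<longleftrightarrow> n = 0 \<and> \<alpha> + \<beta> = -1"
      using assms True by (cases n) (auto simp: s_def)
    moreover have "s * Gamma s = Gamma (s + 1)" if "s \<noteq> 0"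
    proof (subst Gamma_plus1)
      show "s \<notin> \<int>\<^sub>\<le>\<^sub>0" using that pos(3) by (auto elim!: nonpos_Ints_cases)
    qed simp
    ultimately show ?thesis using True by (auto simp: C_def)
  next
    case False
    then have "s > 0" "s - i > 0" using assms by (auto simp: s_def)
    then have "(s - 1) gchoose i = Gamma s / (fact i * Gamma (s - i))"
      by (subst gbinomial_Gamma) (auto elim!: nonpos_Ints_cases)
    moreover have "s * Gamma s = Gamma (s + 1)"
      using \<open>s > 0\<close> by (subst Gamma_plus1) (auto elim!: nonpos_Ints_cases)
    moreover have "Gamma (s - i) \<noteq> 0"
      using Gamma_real_pos[OF \<open>s - i > 0\<close>] by simp
    ultimately show ?thesis using False by (simp add: C_def)
  qed
  have "jacobi_coeff \<alpha> \<beta> n i = C * fact (n + i) / (Gamma (\<beta> + n + i + 1) * Gamma (\<alpha> + n + i + 1))"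
    using Gamma_fact[of "n + i", where 'a = real]
    by (simp add: jacobi_coeff_def C_def s_def algebra_simps)
  moreover have "Beta (\<alpha> + n + i + 1) (\<beta> + n + i + 1)
      = Gamma (\<alpha> + n + i + 1) * Gamma (\<beta> + n + i + 1) / Gamma (s + 1)"
    by (simp add: Beta_def s_def algebra_simps)
  moreover have "2 * real i + (\<alpha> + n) + (\<beta> + n) = s - 1" by (simp add: s_def)
  ultimately have "jacobi_coeff \<alpha> \<beta> n i * (fact i / fact (n + i)) *
      (((2 * real i + (\<alpha> + n) + (\<beta> + n)) gchoose i) * Beta (\<alpha> + n + i + 1) (\<beta> + n + i + 1))
      = (C * fact i * ((s - 1) gchoose i)) / Gamma (s + 1)"
    using G by (simp only:) (simp add: mult_ac)
  moreover have "(C * fact i * ((s - 1) gchoose i)) / Gamma (s + 1) = 1"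
    unfolding C using G by simp
  ultimately show ?thesis by (rule trans)
qed

section \<open>The reproducing property of the kernel\<close>

definition jacobi_kernel_poly :: "real \<Rightarrow> real \<Rightarrow> nat \<Rightarrow> nat \<Rightarrow> real \<Rightarrow> real poly" where
  "jacobi_kernel_poly \<alpha> \<beta> n q t =
     (\<Sum>i\<le>q. smult (jacobi_coeff \<alpha> \<beta> n i * jacobi01 i (\<alpha> + n) (\<beta> + n) t)
              (jacobi_poly (n + i) \<alpha> \<beta>))"

lemma jacobi_kernel_eq:
  "jacobi_kernel \<alpha> \<beta> n q t u = jacobi_weight \<alpha> \<beta> u * poly (jacobi_kernel_poly \<alpha> \<beta> n q t) u"
  by (simp add: jacobi_kernel_def jacobi_kernel_poly_def poly_sum poly_jacobi_poly)

lemma jacobi_kernel_reproducing: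
  assumes "-1 < \<alpha>" "-1 < \<beta>" "degree g \<le> n + q"
  shows "integral {0..1} (\<lambda>u. jacobi_kernel \<alpha> \<beta> n q t u * poly g u) = poly ((pderiv ^^ n) g) t"
proof -
  define a b where "a = \<alpha> + n" and "b = \<beta> + n"
  have ab: "-1 < a" "-1 < b" using assms by (simp_all add: a_def b_def)
  define r where "r = (pderiv ^^ n) g"
  have "degree r \<le> q" using assms(3) by (simp add: r_def degree_higher_pderiv)
  then obtain c where c: "r = (\<Sum>i\<le>q. smult (c i) (jacobi_poly i a b))"
    using jacobi_expansion[OF ab] by blast
  let ?N = "\<lambda>i. ((2 * real i + a + b) gchoose i) * Beta (a + i + 1) (b + i + 1)"
  have ort: "jacobi_moment a b (jacobi_poly i a b * jacobi_poly j a b) = (if i = j then ?N i else 0)" for i j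
  proof (cases i j rule: linorder_cases)
    case less
    then show ?thesis
      using jacobi_orthogonal[OF ab, of "jacobi_poly i a b" j] degree_jacobi_poly_le[of i a b]
      by (simp add: mult.commute)
  next
    case greater
    then show ?thesis
      using jacobi_orthogonal[OF ab, of "jacobi_poly j a b" i] degree_jacobi_poly_le[of j a b] by simp
  qed (simp add: jacobi_norm[OF ab])
  have coef: "jacobi_moment a b (jacobi_poly i a b * r) = c i * ?N i" if "i \<le> q" for i
  proof -
    have "jacobi_poly i a b * r = (\<Sum>j\<le>q. smult (c j) (jacobi_poly i a b * jacobi_poly j a b))"
      by (simp add: c sum_distrib_left)
    then show ?thesis using that ab by (simp add: jacobi_moment_sum ort if_distrib sum.delta cong: if_cong)
  qed
  have "integral {0..1} (\<lambda>u. jacobi_kernel \<alpha> \<beta> n q t u * poly g u)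
      = jacobi_moment \<alpha> \<beta> (jacobi_kernel_poly \<alpha> \<beta> n q t * g)"
    by (simp add: jacobi_moment_def jacobi_kernel_eq mult.assoc)
  also have "\<dots> = (\<Sum>i\<le>q. jacobi_coeff \<alpha> \<beta> n i * jacobi01 i a b t
      * jacobi_moment \<alpha> \<beta> (jacobi_poly (n + i) \<alpha> \<beta> * g))"
    using assms by (simp add: jacobi_kernel_poly_def sum_distrib_right jacobi_moment_sum a_def b_def)
  \<comment> \<open>Coefficient, factorial quotient and squared norm \<open>?N i\<close> multiply to
    1, so just the expansion coefficient \<open>c i\<close> of the \<open>n\<close>-th derivative
    survives.\<close>
  also have "\<dots> = (\<Sum>i\<le>q. c i * jacobi01 i a b t)"
  proof (rule sum.cong)
    fix i assume "i \<in> {..q}"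
    then have "jacobi_coeff \<alpha> \<beta> n i * jacobi01 i a b t
      * jacobi_moment \<alpha> \<beta> (jacobi_poly (n + i) \<alpha> \<beta> * g)
      = (jacobi_coeff \<alpha> \<beta> n i * (fact i / fact (n + i)) * ?N i) * (c i * jacobi01 i a b t)"
      using jacobi_moment_higher_pderiv[OF assms(1,2), of n i g] coef[of i]
      by (simp add: a_def b_def r_def)
    also have "jacobi_coeff \<alpha> \<beta> n i * (fact i / fact (n + i)) * ?N i = 1"
      using jacobi_coeff_mult_norm[OF assms(1,2), of n i] unfolding a_def b_def .
    finally show "jacobi_coeff \<alpha> \<beta> n i * jacobi01 i a b t
      * jacobi_moment \<alpha> \<beta> (jacobi_poly (n + i) \<alpha> \<beta> * g)
      = c i * jacobi01 i a b t" by simp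
  qed simp
  also have "\<dots> = poly r t" by (simp add: c poly_sum poly_jacobi_poly)
  finally show ?thesis by (simp add: r_def)
qed

section \<open>Positivity of the noise and bias constants\<close>

lemma jacobi_abs_moment_pos:
  assumes "-1 < a" "-1 < b" "p \<noteq> 0"
  shows "0 < integral {0..1} (\<lambda>u. \<bar>jacobi_weight a b u * poly p u\<bar>)"
proof (rule ccontr)
  \<comment> \<open>The weight may be singular at the endpoints; raising both exponents by one gives a continuous
    minorant, so that a vanishing integral forces \<open>p\<close> to vanish on the whole interval.\<close>
  let ?\<phi> = "\<lambda>u. jacobi_weight (a + 1) (b + 1) u * \<bar>poly p u\<bar>"
  assume "\<not> ?thesis"
  moreover have cont: "continuous_on {0..1} ?\<phi>"
    unfolding jacobi_weight_def using assms
    by (auto intro!: continuous_intros continuous_on_powr')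
  moreover have "integral {0..1} ?\<phi> \<le> integral {0..1} (\<lambda>u. \<bar>jacobi_weight a b u * poly p u\<bar>)"
  proof (rule integral_le)
    show "?\<phi> integrable_on {0..1}" using cont by (rule integrable_continuous_interval)
    show "(\<lambda>u. \<bar>jacobi_weight a b u * poly p u\<bar>) integrable_on {0..1}"
      using absolutely_integrable_jacobi_weight_mult_continuous[OF assms(1,2), of "poly p"]
      by (simp add: absolutely_integrable_on_def continuous_on_poly continuous_on_id)
    fix u :: real assume u: "u \<in> {0..1}"
    have "jacobi_weight (a + 1) (b + 1) u = (u * (1 - u)) * jacobi_weight a b u"
      using u by (auto simp: jacobi_weight_def powr_add)
    also have "\<dots> \<le> 1 * jacobi_weight a b u"
      using u by (intro mult_right_mono jacobi_weight_nonneg) (auto intro: mult_le_one)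
    finally show "?\<phi> u \<le> \<bar>jacobi_weight a b u * poly p u\<bar>"
      by (simp add: abs_mult mult_right_mono jacobi_weight_nonneg)
  qed
  moreover have "0 \<le> integral {0..1} ?\<phi>"
    using cont by (intro integral_nonneg integrable_continuous_interval) (auto simp: jacobi_weight_nonneg)
  ultimately have "integral {0..1} ?\<phi> = 0" by linarith
  then have zero: "\<forall>u\<in>{0..1}. ?\<phi> u = 0"
    using cont by (subst (asm) integral_eq_0_iff) (auto simp: jacobi_weight_nonneg)
  have "poly p u = 0" if "u \<in> {0<..<1}" for u
    using that zero[rule_format, of u] by (auto simp: jacobi_weight_def)
  then have "{0<..<1} \<subseteq> {u. poly p u = 0}" by blast
  then have "finite {0<..<1::real}" using poly_roots_finite[OF assms(3)] finite_subset by blast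
  then show False by (simp add: infinite_Ioo)
qed

lemma jacobi_kernel_poly_nonzero:
  assumes "-1 < \<alpha>" "-1 < \<beta>"
  shows "jacobi_kernel_poly \<alpha> \<beta> n q t \<noteq> 0"
proof
  assume "jacobi_kernel_poly \<alpha> \<beta> n q t = 0"
  then have "poly ((pderiv ^^ n) (monom 1 n)) t = 0"
    using jacobi_kernel_reproducing[OF assms, of "monom 1 n" n q t]
    by (simp add: jacobi_kernel_eq degree_monom_eq)
  moreover have "(pderiv ^^ n) (monom 1 n) = [:fact n :: real:]"
    by (rule poly_eqI) (auto simp: coeff_higher_pderiv pochhammer_fact coeff_pCons split: nat.split)
  ultimately show False by simp
qed

lemma noise_const_pos:
  assumes "-1 < \<alpha>" "-1 < \<beta>"
  shows "0 < noise_const \<alpha> \<beta> n q t"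
  unfolding noise_const_def jacobi_kernel_eq
  by (intro jacobi_abs_moment_pos jacobi_kernel_poly_nonzero assms)

lemma bias_const_pos:
  assumes "-1 < \<alpha>" "-1 < \<beta>" "0 \<le> t" "0 < M"
  shows "0 < bias_const \<alpha> \<beta> n q t M"
proof -
  \<comment> \<open>The power of \<open>u\<close> is absorbed into the polynomial factor, which
    stays nonzero.\<close>
  have "0 < integral {0..1}
      (\<lambda>u. \<bar>jacobi_weight \<alpha> \<beta> u * poly (monom 1 (n + 1 + q) * jacobi_kernel_poly \<alpha> \<beta> n q t) u\<bar>)"
    using assms jacobi_kernel_poly_nonzero by (intro jacobi_abs_moment_pos) auto
  then have "0 < integral {0..1} (\<lambda>u. \<bar>u ^ (n + 1 + q) * jacobi_kernel \<alpha> \<beta> n q t u\<bar>)"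
    by (simp add: jacobi_kernel_eq poly_monom mult_ac del: power_Suc)
  then show ?thesis
    unfolding bias_const_def using assms by (intro mult_pos_pos add_pos_nonneg) auto
qed

section \<open>Taylor expansion to the left of a point\<close>

lemma Ck_on_has_real_derivative:
  assumes "open I" "Ck_on k I f" "j < k" "x \<in> I"
  shows "((deriv ^^ j) f has_real_derivative (deriv ^^ Suc j) f x) (at x)"
proof -
  have "(deriv ^^ j) f differentiable_on I" using assms by (simp add: Ck_on_def)
  then have "(deriv ^^ j) f differentiable at x"
    using assms differentiable_on_eq_differentiable_at by blast
  then show ?thesis by (simp add: DERIV_deriv_iff_real_differentiable)
qed

lemma Taylor_left_bound:
  fixes diff :: "nat \<Rightarrow> real \<Rightarrow> real"
  assumes "0 < N" "y \<le> x"
    and deriv: "\<And>m s. m < N \<Longrightarrow> s \<in> {y..x} \<Longrightarrow> (diff m has_real_derivative diff (Suc m) s) (at s)"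
    and bound: "\<And>s. s \<in> {y..x} \<Longrightarrow> \<bar>diff N s\<bar> \<le> M"
  shows "\<bar>diff 0 y - (\<Sum>m<N. diff m x / fact m * (y - x) ^ m)\<bar> \<le> M * (x - y) ^ N / fact N"
\<comment> \<open>The intermediate point of Taylor's theorem requires \<open>y\<close> and
  \<open>x\<close> to differ.\<close>
proof (cases "y = x")
  case True
  have "(\<Sum>m<N. diff m x / fact m * 0 ^ m) = (\<Sum>m<N. if m = 0 then diff 0 x else 0)"
    by (intro sum.cong) auto
  then show ?thesis using True assms(1) by (simp add: zero_power)
next
  case False
  then obtain s where s: "y < s" "s < x" and
    eq: "diff 0 y = (\<Sum>m<N. diff m x / fact m * (y - x) ^ m) + diff N s / fact N * (y - x) ^ N"
    using Taylor[of N diff "diff 0" y x x y] assms by auto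
  have "\<bar>diff N s / fact N * (y - x) ^ N\<bar> = \<bar>diff N s\<bar> * (x - y) ^ N / fact N"
    using \<open>y \<le> x\<close> by (simp add: abs_mult power_abs)
  also have "\<dots> \<le> M * (x - y) ^ N / fact N"
    using s bound[of s] \<open>y \<le> x\<close> by (intro divide_right_mono mult_right_mono) auto
  finally show ?thesis using eq by simp
qed

text \<open>Differentiating \<open>n\<close> times multiplies the coefficient of degree
  \<open>n + i\<close> by \<open>fact (n + i) / fact i\<close>, so Taylor coefficients go to Taylor
  coefficients.\<close>

lemma poly_higher_pderiv_sum_monom:
  fixes c :: "nat \<Rightarrow> real"
  shows "poly ((pderiv ^^ n) (\<Sum>m\<le>n + q. monom (c m / fact m) m)) t = (\<Sum>i\<le>q. c (n + i) / fact i * t ^ i)"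
proof -
  let ?g = "\<Sum>m\<le>n + q. monom (c m / fact m) m"
  have coeff: "coeff ?g m = (if m \<le> n + q then c m / fact m else 0)" for m
    by (simp add: coeff_sum)
  have "degree ?g \<le> n + q"
    by (intro degree_sum_le) (auto intro: order_trans[OF degree_monom_le])
  then have "poly ((pderiv ^^ n) ?g) t = (\<Sum>i\<le>q. coeff ((pderiv ^^ n) ?g) i * t ^ i)"
    by (subst poly_as_sum_of_monoms'[symmetric, of _ q])
      (simp_all add: degree_higher_pderiv poly_sum poly_monom)
  also have "\<dots> = (\<Sum>i\<le>q. c (n + i) / fact i * t ^ i)"
  proof (intro sum.cong refl)
    fix i assume i: "i \<in> {..q}"
    have "fact (n + i) = fact i * pochhammer (1 + real i) n"
      using pochhammer_product'[of "1 :: real" i n] by (simp add: pochhammer_fact add.commute)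
    moreover have "pochhammer (1 + real i) n > 0" by (intro pochhammer_pos) simp
    ultimately show "coeff ((pderiv ^^ n) ?g) i * t ^ i = c (n + i) / fact i * t ^ i"
      using i by (simp add: coeff_higher_pderiv coeff add.commute[of i])
  qed
  finally show ?thesis .
qed

section \<open>Pointwise estimate of the estimation error\<close>

text \<open>The change of variables carries absolute integrability from the segment to the unit
  interval; the Jacobian factor \<open>h\<close> is then divided out.\<close>

lemma measurable_affine_noise:
  fixes h x :: real and \<omega> :: "real \<Rightarrow> real"
  assumes "0 < h" "\<omega> absolutely_integrable_on I" "{x - h..x} \<subseteq> I"
  shows "(\<lambda>u. \<omega> (x - h * u)) \<in> borel_measurable (lebesgue_on {0..1})"
proof -
  have image: "(\<lambda>u. x - h * u) ` {0..1} = {x - h..x}"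
  proof (intro equalityI subsetI)
    fix y assume "y \<in> {x - h..x}"
    then show "y \<in> (\<lambda>u. x - h * u) ` {0..1}"
      using assms(1) by (intro image_eqI[of _ _ "(x - y) / h"]) (auto simp: field_simps)
  qed (use assms(1) in \<open>auto simp: mult_left_le\<close>)
  have "\<omega> absolutely_integrable_on (\<lambda>u. x - h * u) ` {0..1}"
    unfolding image by (rule set_integrable_subset[OF assms(2) _ assms(3)]) simp
  moreover have "\<omega> absolutely_integrable_on (\<lambda>u. x - h * u) ` {0..1}
      \<longleftrightarrow> (\<lambda>u. \<bar>- h\<bar> *\<^sub>R \<omega> (x - h * u)) absolutely_integrable_on {0..1}"
    by (rule absolutely_integrable_change_of_variables_real[of _ "\<lambda>u. x - h * u" "\<lambda>_. - h" \<omega>])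
      (use assms(1) in \<open>auto intro!: derivative_eq_intros simp: inj_on_def\<close>)
  ultimately have "(\<lambda>u. \<bar>- h\<bar> *\<^sub>R \<omega> (x - h * u)) absolutely_integrable_on {0..1}"
    by blast
  then have "(\<lambda>u. h * \<omega> (x - h * u)) \<in> borel_measurable (lebesgue_on {0..1})"
    using assms(1) by (auto dest!: absolutely_integrable_imp_borel_measurable)
  then have "(\<lambda>u. (h * \<omega> (x - h * u)) / h) \<in> borel_measurable (lebesgue_on {0..1})"
    by measurable
  then show ?thesis using assms(1) by simp
qed

lemma jacobi_estimator_error:
  assumes "-1 < \<alpha>" "-1 < \<beta>" and t: "t \<in> {0..1}"
    and "open I" and Ck: "Ck_on (n + 1 + q) I f"
    and M: "\<forall>x\<in>I. \<bar>(deriv ^^ (n + q + 1)) f x\<bar> \<le> M"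
    and h: "0 < h" and xI: "{x - h..x} \<subseteq> I"
    and \<omega>: "\<omega> absolutely_integrable_on I" and \<delta>: "\<And>y. y \<in> I \<Longrightarrow> \<bar>\<omega> y\<bar> \<le> \<delta>"
  shows "\<bar>causal_jacobi_estimator n h \<alpha> \<beta> q t (\<lambda>y. f y + \<omega> y) x - (deriv ^^ n) f (x - t * h)\<bar>
    \<le> bias_const \<alpha> \<beta> n q t M * h ^ (q + 1) + noise_const \<alpha> \<beta> n q t * (\<delta> / h ^ n)"
proof -
  define N where "N = n + q + 1"
  define d where "d m = (deriv ^^ m) f" for m
  have d: "(d m has_real_derivative d (Suc m) s) (at s)" if "m < N" "s \<in> I" for m s
    unfolding d_def using that Ck \<open>open I\<close> by (intro Ck_on_has_real_derivative) (simp_all add: N_def)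
  have dN: "\<bar>d N s\<bar> \<le> M" if "s \<in> I" for s using M that by (simp add: d_def N_def)
  define k where "k = jacobi_kernel \<alpha> \<beta> n q t"
  \<comment> \<open>The Taylor polynomial of \<open>f\<close> at \<open>x\<close>, rewritten in
    \<open>u\<close> through the substitution of \<open>x - h * u\<close>, which produces the powers
    of \<open>- h\<close>.\<close>
  define g where "g = (\<Sum>m\<le>n + q. monom (d m x * (- h) ^ m / fact m) m)"
  define R where "R u = f (x - h * u) - poly g u" for u
  define W where "W u = \<omega> (x - h * u)" for u
  define A where "A = integral {0..1} (\<lambda>u. \<bar>u ^ N * k u\<bar>)"
  define E where "E = integral {0..1} (\<lambda>u. \<bar>k u\<bar>)"
  have mem: "x - h * u \<in> I" if "u \<in> {0..1}" for u
    using that h xI by (auto simp: mult_left_le intro!: subsetD[OF xI])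

  have poly_g: "poly g u = (\<Sum>m<N. d m x / fact m * (x - h * u - x) ^ m)" for u
  proof -
    have "(x - h * u - x) ^ m = (- h) ^ m * u ^ m" for m
      by (simp flip: power_mult_distrib)
    then show ?thesis
      by (simp add: g_def N_def poly_sum poly_monom lessThan_Suc_atMost mult.assoc)
  qed
  have R_bound: "\<bar>R u\<bar> \<le> M * h ^ N / fact N * u ^ N" if "u \<in> {0..1}" for u
  proof -
    have "\<bar>d 0 (x - h * u) - (\<Sum>m<N. d m x / fact m * (x - h * u - x) ^ m)\<bar>
        \<le> M * (x - (x - h * u)) ^ N / fact N"
    proof (rule Taylor_left_bound)
      show "0 < N" "x - h * u \<le> x" using that h by (simp_all add: N_def)
      have "h * u \<le> h" using that h by (simp add: mult_left_le)
      then have sub: "{x - h * u..x} \<subseteq> I" using xI by auto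
      show "(d m has_real_derivative d (Suc m) s) (at s)" if "m < N" "s \<in> {x - h * u..x}" for m s
        using that d sub by blast
      show "\<bar>d N s\<bar> \<le> M" if "s \<in> {x - h * u..x}" for s
        using that dN sub by blast
    qed
    then show ?thesis by (simp add: R_def poly_g d_def power_mult_distrib)
  qed

  have k: "k u = jacobi_weight \<alpha> \<beta> u * poly (jacobi_kernel_poly \<alpha> \<beta> n q t) u" for u
    by (simp add: k_def jacobi_kernel_eq)
  have k_cont: "(\<lambda>u. k u * p u) absolutely_integrable_on {0..1}" if "continuous_on {0..1} p" for p
    unfolding k mult.assoc using that assms(1,2)
    by (intro absolutely_integrable_jacobi_weight_mult_continuous continuous_intros)
  have k_abs: "(\<lambda>u. \<bar>u ^ m * k u\<bar>) integrable_on {0..1}" for m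
    using k_cont[of "\<lambda>u. u ^ m"]
    by (simp add: absolutely_integrable_on_def mult.commute[of "_ ^ m"] continuous_on_power continuous_on_id)
  have "continuous_on I f"
    using Ck unfolding Ck_on_def by (metis funpow_0 le0)
  then have f_cont: "continuous_on {0..1} (\<lambda>u. f (x - h * u))"
    by (rule continuous_on_compose2) (use mem in \<open>auto intro!: continuous_intros\<close>)
  then have int_R: "(\<lambda>u. k u * R u) integrable_on {0..1}"
    unfolding R_def by (intro set_lebesgue_integral_eq_integral(1) k_cont continuous_intros)
  have int_g: "(\<lambda>u. k u * poly g u) integrable_on {0..1}"
    by (intro set_lebesgue_integral_eq_integral(1) k_cont continuous_intros)
  \<comment> \<open>The polynomial part of the kernel is grouped with the noise into a bounded
    measurable factor, leaving the possibly singular weight as the integrable one.\<close>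
  have int_W: "(\<lambda>u. k u * W u) integrable_on {0..1}"
    unfolding k mult.assoc
  proof (intro set_lebesgue_integral_eq_integral(1) absolutely_integrable_jacobi_weight_mult assms(1,2))
    let ?p = "poly (jacobi_kernel_poly \<alpha> \<beta> n q t)"
    have "?p \<in> borel_measurable (lebesgue_on {0..1})"
      by (intro continuous_imp_measurable_on_sets_lebesgue continuous_intros) auto
    then show "(\<lambda>u. ?p u * W u) \<in> borel_measurable (lebesgue_on {0..1})"
      unfolding W_def using measurable_affine_noise[OF h \<omega> xI] by (rule borel_measurable_times)
    have "bounded (?p ` {0..1})"
      by (intro compact_imp_bounded compact_continuous_image continuous_intros) auto
    then obtain B where B: "\<And>u. u \<in> {0..1} \<Longrightarrow> \<bar>?p u\<bar> \<le> B"
      unfolding bounded_iff by fastforce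
    have "\<bar>?p u * W u\<bar> \<le> B * \<delta>" if "u \<in> {0..1}" for u
      unfolding abs_mult W_def using B[OF that] \<delta>[OF mem[OF that]] by (intro mult_mono) auto
    then show "bounded ((\<lambda>u. ?p u * W u) ` {0..1})" by (auto intro!: boundedI[of _ "B * \<delta>"])
  qed

  have "degree g \<le> n + q"
    unfolding g_def by (intro degree_sum_le) (auto intro: order_trans[OF degree_monom_le])
  then have "integral {0..1} (\<lambda>u. k u * poly g u) = poly ((pderiv ^^ n) g) t"
    unfolding k_def using assms by (intro jacobi_kernel_reproducing)
  also have "\<dots> = (- h) ^ n * (\<Sum>i\<le>q. d (n + i) x / fact i * (- (t * h)) ^ i)"
  proof -
    have "(- (t * h)) ^ i = (- h) ^ i * t ^ i" for i
      by (simp add: mult.commute flip: power_mult_distrib)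
    then show ?thesis
      unfolding g_def poly_higher_pderiv_sum_monom by (simp add: sum_distrib_left power_add mult_ac)
  qed
  \<comment> \<open>The normalisation cancels the \<open>(- h) ^ n\<close> from the
    \<open>n\<close>-fold derivative; what remains is the Taylor polynomial of the
    \<open>n\<close>-th derivative at the delayed point.\<close>
  finally have main: "integral {0..1} (\<lambda>u. k u * poly g u) / (- h) ^ n
      = (\<Sum>i\<le>q. d (n + i) x / fact i * (- (t * h)) ^ i)" (is "_ = ?T")
    using h by simp
  \<comment> \<open>This second remainder yields the summand with \<open>t ^ (q + 1)\<close> in
    \<open>bias_const\<close>.\<close>
  have T: "\<bar>d n (x - t * h) - ?T\<bar> \<le> M * (t * h) ^ (q + 1) / fact (q + 1)"
  proof -
    have "\<bar>d (n + 0) (x - t * h) - (\<Sum>m<q + 1. d (n + m) x / fact m * (x - t * h - x) ^ m)\<bar>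
        \<le> M * (x - (x - t * h)) ^ (q + 1) / fact (q + 1)"
    proof (rule Taylor_left_bound[where diff = "\<lambda>m. d (n + m)"])
      show "0 < q + 1" "x - t * h \<le> x" using t h by simp_all
      have "t * h \<le> h" using t h by (simp add: mult_le_cancel_right1)
      then have sub: "{x - t * h..x} \<subseteq> I" using xI by auto
      show "(d (n + m) has_real_derivative d (n + Suc m) s) (at s)"
        if "m < q + 1" "s \<in> {x - t * h..x}" for m s
        using that d[of "n + m" s] sub by (auto simp: N_def)
      show "\<bar>d (n + (q + 1)) s\<bar> \<le> M" if "s \<in> {x - t * h..x}" for s
        using that dN[of s] sub by (auto simp: N_def add.assoc)
    qed
    then show ?thesis by (simp add: lessThan_Suc_atMost)
  qed

  have "causal_jacobi_estimator n h \<alpha> \<beta> q t (\<lambda>y. f y + \<omega> y) x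
      = integral {0..1} (\<lambda>u. k u * poly g u + k u * R u + k u * W u) / (- h) ^ n"
    by (simp add: causal_jacobi_estimator_def k_def R_def W_def algebra_simps)
  also have "\<dots> = ?T + integral {0..1} (\<lambda>u. k u * R u) / (- h) ^ n
                 + integral {0..1} (\<lambda>u. k u * W u) / (- h) ^ n"
    using int_g int_R int_W
    by (simp add: Henstock_Kurzweil_Integration.integral_add integrable_add add_divide_distrib main)
  finally have est: "causal_jacobi_estimator n h \<alpha> \<beta> q t (\<lambda>y. f y + \<omega> y) x - d n (x - t * h)
      = integral {0..1} (\<lambda>u. k u * R u) / (- h) ^ n + integral {0..1} (\<lambda>u. k u * W u) / (- h) ^ n
        + (?T - d n (x - t * h))" by simp

  \<comment> \<open>Keeping \<open>u ^ N\<close> from the Taylor remainder under the integral gives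
    the weighted moment in \<open>bias_const\<close>.\<close>
  have "norm (integral {0..1} (\<lambda>u. k u * R u)) \<le> integral {0..1} (\<lambda>u. M * h ^ N / fact N * \<bar>u ^ N * k u\<bar>)"
  proof (rule Henstock_Kurzweil_Integration.integral_norm_bound_integral[OF int_R])
    show "(\<lambda>u. M * h ^ N / fact N * \<bar>u ^ N * k u\<bar>) integrable_on {0..1}"
      by (intro integrable_on_mult_right k_abs)
    fix u :: real assume u: "u \<in> {0..1}"
    have "\<bar>k u\<bar> * \<bar>R u\<bar> \<le> \<bar>k u\<bar> * (M * h ^ N / fact N * u ^ N)"
      using R_bound[OF u] by (rule mult_left_mono) simp
    then show "norm (k u * R u) \<le> M * h ^ N / fact N * \<bar>u ^ N * k u\<bar>"
      using u by (simp add: abs_mult mult_ac)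
  qed
  then have IR: "\<bar>integral {0..1} (\<lambda>u. k u * R u)\<bar> \<le> M * h ^ N / fact N * A"
    by (simp add: A_def)
  have "norm (integral {0..1} (\<lambda>u. k u * W u)) \<le> integral {0..1} (\<lambda>u. \<delta> * \<bar>k u\<bar>)"
  proof (rule Henstock_Kurzweil_Integration.integral_norm_bound_integral[OF int_W])
    show "(\<lambda>u. \<delta> * \<bar>k u\<bar>) integrable_on {0..1}"
      using k_abs[of 0] by (intro integrable_on_mult_right) simp
    fix u :: real assume u: "u \<in> {0..1}"
    show "norm (k u * W u) \<le> \<delta> * \<bar>k u\<bar>"
      using mult_right_mono[OF \<delta>[OF mem[OF u]], of "\<bar>k u\<bar>"] by (simp add: abs_mult W_def mult.commute)
  qed
  then have IW: "\<bar>integral {0..1} (\<lambda>u. k u * W u)\<bar> \<le> \<delta> * E"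
    by (simp add: E_def)

  have "\<bar>causal_jacobi_estimator n h \<alpha> \<beta> q t (\<lambda>y. f y + \<omega> y) x - d n (x - t * h)\<bar>
      \<le> \<bar>integral {0..1} (\<lambda>u. k u * R u)\<bar> / h ^ n + \<bar>integral {0..1} (\<lambda>u. k u * W u)\<bar> / h ^ n
        + \<bar>d n (x - t * h) - ?T\<bar>"
    unfolding est using h
    by (intro order_trans[OF abs_triangle_ineq] add_mono)
      (auto simp: abs_divide power_abs abs_minus_commute)
  also have "\<dots> \<le> M * h ^ N / fact N * A / h ^ n + \<delta> * E / h ^ n + M * (t * h) ^ (q + 1) / fact (q + 1)"
    using h by (intro add_mono divide_right_mono IR IW T) auto
  also have "\<dots> = M * (1 / fact N * A + t ^ (q + 1) / fact (q + 1)) * h ^ (q + 1) + E * (\<delta> / h ^ n)"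
  proof -
    have "h ^ N / h ^ n = h ^ (q + 1)" using h by (simp add: N_def power_add)
    then have "M * h ^ N / fact N * A / h ^ n = M * (1 / fact N * A) * h ^ (q + 1)"
      by (metis (no_types, lifting) mult.assoc mult.commute mult.left_neutral times_divide_eq_left
          times_divide_eq_right)
    then show ?thesis
      by (simp add: power_mult_distrib distrib_left distrib_right mult_ac del: power_Suc)
  qed
  also have "M * (1 / fact N * A + t ^ (q + 1) / fact (q + 1)) = bias_const \<alpha> \<beta> n q t M"
    by (simp add: bias_const_def A_def N_def k_def add.assoc add.commute[of 1] del: fact_Suc power_Suc)
  also have "E = noise_const \<alpha> \<beta> n q t"
    by (simp add: E_def k_def noise_const_def)
  finally show ?thesis by (simp add: d_def)
qed

section \<open>Supremum bound and the optimal width\<close>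

lemma estimation_error_le:
  assumes "-1 < \<alpha>" "-1 < \<beta>" "t \<in> {0..1}" "open I" "Ck_on (n + 1 + q) I f"
    "\<forall>x\<in>I. \<bar>(deriv ^^ (n + q + 1)) f x\<bar> \<le> M" "0 < h" "noise_with_level I \<delta> \<omega>"
  shows "estimation_error n h \<alpha> \<beta> q t I f \<omega>
    \<le> ennreal (bias_const \<alpha> \<beta> n q t M * h ^ (q + 1) + noise_const \<alpha> \<beta> n q t * (\<delta> / h ^ n))"
  unfolding estimation_error_def sup_norm_on_def
proof (intro SUP_least ennreal_leI)
  fix x assume "x \<in> causal_domain I h"
  then have x: "{x - h..x} \<subseteq> I" by (simp add: causal_domain_def)
  have \<omega>: "\<omega> absolutely_integrable_on I" and \<delta>: "0 \<le> \<delta>" "sup_norm_on I \<omega> = ennreal \<delta>"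
    using assms(8) by (simp_all add: noise_with_level_def)
  have "\<bar>\<omega> y\<bar> \<le> \<delta>" if "y \<in> I" for y
  proof -
    have "ennreal \<bar>\<omega> y\<bar> \<le> sup_norm_on I \<omega>"
      unfolding sup_norm_on_def using that by (rule SUP_upper)
    then show ?thesis using \<delta> by simp
  qed
  then show "\<bar>causal_jacobi_estimator n h \<alpha> \<beta> q t (\<lambda>y. f y + \<omega> y) x - (deriv ^^ n) f (x - t * h)\<bar>
      \<le> bias_const \<alpha> \<beta> n q t M * h ^ (q + 1) + noise_const \<alpha> \<beta> n q t * (\<delta> / h ^ n)"
    using assms x \<omega> by (intro jacobi_estimator_error)
qed

theorem proposition1:
  fixes n q :: nat and \<alpha> \<beta> t M :: real and I :: "real set" and f :: "real \<Rightarrow> real"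
  assumes "-1 < \<alpha>" and "-1 < \<beta>"
    and "t \<in> {0..1}"
    and "open I" and "is_interval I"
    and "Ck_on (n + 1 + q) I f"
    and "M > 0"
    and "\<forall>x\<in>I. \<bar>(deriv ^^ (n + q + 1)) f x\<bar> \<le> M"
  shows "(\<forall>h>0. \<forall>\<delta> \<omega>. noise_with_level I \<delta> \<omega> \<longrightarrow>
            estimation_error n h \<alpha> \<beta> q t I f \<omega>
              \<le> ennreal (bias_const \<alpha> \<beta> n q t M * h ^ (q + 1)
                          + noise_const \<alpha> \<beta> n q t * (\<delta> / h ^ n)))
       \<and> (1 \<le> n \<longrightarrow>
            (\<exists>K::real. \<forall>\<^sub>F \<delta> in at_right 0. \<forall>\<omega>. noise_with_level I \<delta> \<omega> \<longrightarrow>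
               estimation_error n (optimal_width \<alpha> \<beta> n q t M \<delta>) \<alpha> \<beta> q t I f \<omega>
                 \<le> ennreal (K * \<delta> powr (real (q + 1) / real (n + 1 + q)))))"
proof (intro conjI impI)
  show "\<forall>h>0. \<forall>\<delta> \<omega>. noise_with_level I \<delta> \<omega> \<longrightarrow>
            estimation_error n h \<alpha> \<beta> q t I f \<omega>
              \<le> ennreal (bias_const \<alpha> \<beta> n q t M * h ^ (q + 1)
                          + noise_const \<alpha> \<beta> n q t * (\<delta> / h ^ n))"
    using assms estimation_error_le by blast
next
  assume n: "1 \<le> n"
  let ?C = "bias_const \<alpha> \<beta> n q t M" and ?E = "noise_const \<alpha> \<beta> n q t"
  define N where "N = real (n + 1 + q)"
  \<comment> \<open>The factor of the optimal width that does not depend on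
    \<open>\<delta>\<close>.\<close>
  define c where "c = (real n * ?E / (real (q + 1) * ?C)) powr (1 / N)"
  have pos: "0 < ?C" "0 < ?E"
    using assms by (auto intro: bias_const_pos noise_const_pos)
  then have c: "0 < c" using n by (simp add: c_def)
  have N: "0 < N" by (simp add: N_def)
  show "\<exists>K. \<forall>\<^sub>F \<delta> in at_right 0. \<forall>\<omega>. noise_with_level I \<delta> \<omega> \<longrightarrow>
               estimation_error n (optimal_width \<alpha> \<beta> n q t M \<delta>) \<alpha> \<beta> q t I f \<omega>
                 \<le> ennreal (K * \<delta> powr (real (q + 1) / real (n + 1 + q)))"
  proof (intro exI)
    show "\<forall>\<^sub>F \<delta> in at_right 0. \<forall>\<omega>. noise_with_level I \<delta> \<omega> \<longrightarrow>
               estimation_error n (optimal_width \<alpha> \<beta> n q t M \<delta>) \<alpha> \<beta> q t I f \<omega>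
                 \<le> ennreal ((?C * c ^ (q + 1) + ?E / c ^ n) * \<delta> powr (real (q + 1) / real (n + 1 + q)))"
      \<comment> \<open>The bound holds for every positive \<open>\<delta>\<close>, not just for
        small ones.\<close>
      using eventually_at_right_less[of "0::real"]
    proof eventually_elim
      case (elim \<delta>)
      let ?h = "optimal_width \<alpha> \<beta> n q t M \<delta>"
      have h: "?h = c * \<delta> powr (1 / N)"
      proof -
        have "n + q + 1 = n + 1 + q" by simp
        then show ?thesis
          unfolding optimal_width_def c_def N_def using pos elim by (simp only: powr_mult)
      qed
      have h_pow: "?h ^ m = c ^ m * \<delta> powr (real m / N)" for m
        using elim by (simp add: h power_mult_distrib powr_powr flip: powr_realpow)
      then have "?h ^ (q + 1) = c ^ (q + 1) * \<delta> powr (real (q + 1) / N)" .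
      moreover have "\<delta> / ?h ^ n = \<delta> powr (real (q + 1) / N) / c ^ n"
      proof -
        \<comment> \<open>This balance of exponents gives the noise term the same power of
          \<open>\<delta>\<close> as the bias term.\<close>
        have "real n / N + real (q + 1) / N = 1"
          using N by (simp add: N_def flip: add_divide_distrib)
        then have "\<delta> = \<delta> powr (real n / N) * \<delta> powr (real (q + 1) / N)"
          using elim by (simp flip: powr_add del: of_nat_add)
        then show ?thesis using c elim by (simp add: h_pow field_simps)
      qed
      ultimately have "?C * ?h ^ (q + 1) + ?E * (\<delta> / ?h ^ n)
          = (?C * c ^ (q + 1) + ?E / c ^ n) * \<delta> powr (real (q + 1) / real (n + 1 + q))"
        unfolding N_def by (simp only: distrib_right) simp
      moreover have "0 < ?h" using c elim by (simp add: h)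
      ultimately show ?case using assms estimation_error_le[of \<alpha> \<beta> t I n q f M ?h \<delta>] by simp
    qed
  qed
qed

end
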